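(* There do not exist coprime positive integers $a,b$ such that every positive integer $n$ is an $(a,b)$ cobalancing number.
   Context: For coprime positive integers $a,b$, an $(a,b)$ cobalancing number is a positive integer $n$ such that $$a\left(1+2+\cdots+n\right)=b\left((n+1)+(n+2)+\cdots+(n+r)\right)$$ for some positive integer $r$; this $r$ is called the cobalancer of $n$. *)

theory Defs
  imports Main
begin

definition is_cobalancer :: "nat \<Rightarrow> nat \<Rightarrow> nat \<Rightarrow> nat \<Rightarrow> bool" where
  "is_cobalancer a b n r \<longleftrightarrow>
     r > 0 \<and> a * (\<Sum>k = 1..n. k) = b * (\<Sum>k = n + 1..n + r. k)"

(* The parameters a, b are meant to be positive and coprime; this is required where
   the notion is used, not here. *)
definition cobalancing_number :: "nat \<Rightarrow> nat \<Rightarrow> nat \<Rightarrow> bool" where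
  "cobalancing_number a b n \<longleftrightarrow> n > 0 \<and> (\<exists>r. is_cobalancer a b n r)"

end

theory Submission
  imports Defs
begin

text \<open>
  Already \<open>n = 1\<close> and \<open>n = 8\<close> cannot both be cobalancing. With cobalancers \<open>r\<close> and \<open>q\<close> the two
  defining equations read \<open>2 a = b r (r + 3)\<close> and \<open>72 a = b q (q + 17)\<close>, and eliminating \<open>a\<close> and
  \<open>b\<close> leaves \<open>36 r (r + 3) = q (q + 17)\<close>. As \<open>1 + \<dots> + 8 = 36\<close> is a perfect square, this is
  impossible by size: the left side lies strictly between the values of \<open>q (q + 17)\<close> at
  \<open>q = 6 r\<close> and \<open>q = 6 r + 1\<close>.
\<close>

text \<open>Doubling keeps the arithmetic series free of division on \<open>nat\<close>; the
  instance \<open>n = 0\<close> also evaluates the sum \<open>1 + ... + n\<close>.\<close>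

lemma double_sum_from_Suc: "2 * (\<Sum>k = n + 1..n + r. k) = r * (2 * n + r + 1)" for n r :: nat
  by (induction r) (simp_all add: algebra_simps)

lemma is_cobalancer_imp_eq:
  assumes "is_cobalancer a b n r"
  shows "a * (n * (n + 1)) = b * (r * (2 * n + r + 1))"
proof -
  have "a * (\<Sum>k = 1..n. k) = b * (\<Sum>k = n + 1..n + r. k)"
    using assms by (simp add: is_cobalancer_def)
  then have "a * (2 * (\<Sum>k = 1..n. k)) = b * (2 * (\<Sum>k = n + 1..n + r. k))"
    by (metis mult.left_commute)
  moreover have "2 * (\<Sum>k = 1..n. k) = n * (n + 1)"
    using double_sum_from_Suc[of 0 n] by simp
  ultimately show ?thesis
    by (simp only: double_sum_from_Suc)
qed

lemma no_square_scaled_solution: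
  fixes q r :: nat
  assumes "r > 0"
  shows "36 * (r * (r + 3)) \<noteq> q * (q + 17)"
proof (cases "q \<le> 6 * r")
  case True
  then have "q * (q + 17) \<le> 6 * r * (6 * r + 17)"
    by (intro mult_mono) auto
  \<comment> \<open>The right side exceeds the left by \<open>6 * r\<close>, so strictness is
    exactly \<open>r > 0\<close>.\<close>
  also have "\<dots> < 36 * (r * (r + 3))"
    using assms by (simp add: algebra_simps)
  finally show ?thesis by simp
next
  case False
  \<comment> \<open>Here the gap is \<open>6 * r + 18\<close>.\<close>
  have "36 * (r * (r + 3)) < (6 * r + 1) * (6 * r + 1 + 17)"
    by (simp add: algebra_simps)
  also have "\<dots> \<le> q * (q + 17)"
    using False by (intro mult_mono) auto
  finally show ?thesis by simp
qed

lemma not_cobalancing_1_and_8: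
  assumes "b > 0" "cobalancing_number a b 1" "cobalancing_number a b 8"
  shows False
proof -
  obtain r q where r: "is_cobalancer a b 1 r" and q: "is_cobalancer a b 8 q"
    using assms by (auto simp: cobalancing_number_def)
  have "2 * a = b * (r * (r + 3))"
    using is_cobalancer_imp_eq[OF r] by (simp add: algebra_simps)
  moreover have "72 * a = b * (q * (q + 17))"
    using is_cobalancer_imp_eq[OF q] by (simp add: algebra_simps)
  \<comment> \<open>Both sides equal \<open>72 * a\<close>: the first equation is scaled by
    36.\<close>
  ultimately have "b * (36 * (r * (r + 3))) = b * (q * (q + 17))"
    by linarith
  then have "36 * (r * (r + 3)) = q * (q + 17)"
    using \<open>b > 0\<close> by simp
  moreover have "r > 0"
    using r by (simp add: is_cobalancer_def)
  ultimately show False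
    using no_square_scaled_solution by blast
qed

theorem theorem1p10:
  shows "\<not> (\<exists>a b :: nat. a > 0 \<and> b > 0 \<and> coprime a b \<and>
            (\<forall>n > 0. cobalancing_number a b n))"
  using not_cobalancing_1_and_8 by (metis zero_less_numeral zero_less_one)

end
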